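(* For every $n\ge 5$, the difference graph $\mathcal{D}(S_n)$ of the symmetric group $S_n$ on $n$ letters is neither a split graph nor a threshold graph.
   Context: Difference graph: for a finite group $G$, the power graph $\mathcal{P}(G)$ is the simple undirected graph with vertex set $G$ in which distinct $a,b$ are adjacent iff $a\in\langle b\rangle$ or $b\in\langle a\rangle$. The enhanced power graph $\mathcal{P}_E(G)$ is the simple undirected graph with vertex set $G$ in which distinct $a,b$ are adjacent iff $a,b\in\langle c\rangle$ for some $c\in G$. The difference graph $\mathcal{D}(G)$ is obtained from the graph $\mathcal{P}_E(G)-\mathcal{P}(G)$ (vertex set $G$; two vertices are adjacent iff they are adjacent in $\mathcal{P}_E(G)$ but not in $\mathcal{P}(G)$) by removing all isolated vertices. A graph is split if its vertex set is the disjoint union of two subsets, one inducing a complete graph and the other an edgeless graph. A graph is threshold if it has no induced subgraph isomorphic to $C_4$ (cycle on 4 vertices), $P_4$ (path on 4 vertices) or $2K_2$ (disjoint union of two edges). *)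

theory Defs
  imports "HOL-Algebra.Sym_Groups" "HOL-Algebra.Generated_Groups" "Graph_Theory.Graph_Theory"
begin

text \<open>
  As in the Graph Theory library, a simple undirected graph is a symmetric loop-free digraph
  without parallel arcs, so an edge between a and b is the pair of arcs (a, b), (b, a).
\<close>

definition power_graph :: "('a, 'm) monoid_scheme \<Rightarrow> 'a pair_pre_digraph" where
  "power_graph G =
    \<lparr> pverts = carrier G,
      parcs = {(a, b). a \<in> carrier G \<and> b \<in> carrier G \<and> a \<noteq> b \<and>
                 (a \<in> generate G {b} \<or> b \<in> generate G {a})} \<rparr>"

definition enhanced_power_graph :: "('a, 'm) monoid_scheme \<Rightarrow> 'a pair_pre_digraph" where
  "enhanced_power_graph G =
    \<lparr> pverts = carrier G,
      parcs = {(a, b). a \<in> carrier G \<and> b \<in> carrier G \<and> a \<noteq> b \<and>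
                 (\<exists>c\<in>carrier G. a \<in> generate G {c} \<and> b \<in> generate G {c})} \<rparr>"

definition graph_minus :: "'a pair_pre_digraph \<Rightarrow> 'a pair_pre_digraph \<Rightarrow> 'a pair_pre_digraph" where
  "graph_minus H K = \<lparr> pverts = pverts H, parcs = parcs H - parcs K \<rparr>"

definition delete_isolated :: "'a pair_pre_digraph \<Rightarrow> 'a pair_pre_digraph" where
  "delete_isolated H =
    \<lparr> pverts = {v \<in> pverts H. \<exists>w. (v, w) \<in> parcs H \<or> (w, v) \<in> parcs H}, parcs = parcs H \<rparr>"

definition difference_graph :: "('a, 'm) monoid_scheme \<Rightarrow> 'a pair_pre_digraph" where
  "difference_graph G = delete_isolated (graph_minus (enhanced_power_graph G) (power_graph G))"

lemma pair_graph_power_graph: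
  "finite (carrier G) \<Longrightarrow> pair_graph (power_graph G)"
  by unfold_locales
    (auto simp: power_graph_def symmetric_def intro!: symI
      intro: finite_subset[of _ "carrier G \<times> carrier G"])

lemma pair_graph_enhanced_power_graph:
  "finite (carrier G) \<Longrightarrow> pair_graph (enhanced_power_graph G)"
  by unfold_locales
    (auto simp: enhanced_power_graph_def symmetric_def intro!: symI
      intro: finite_subset[of _ "carrier G \<times> carrier G"])

lemma pair_graph_difference_graph:
  "finite (carrier G) \<Longrightarrow> pair_graph (difference_graph G)"
  by unfold_locales
    (auto simp: difference_graph_def delete_isolated_def graph_minus_def power_graph_def
      enhanced_power_graph_def symmetric_def intro!: symI
      intro: finite_subset[of _ "carrier G \<times> carrier G"])

text \<open>Either part may be empty.\<close>

definition split_graph :: "('a, 'b) pre_digraph \<Rightarrow> bool" where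
  "split_graph G \<longleftrightarrow>
    (\<exists>A B. A \<union> B = verts G \<and> A \<inter> B = {} \<and>
       complete_digraph (card A) (G \<restriction> A) \<and> arcs (G \<restriction> B) = {})"

definition undirected :: "'a set \<Rightarrow> 'a rel \<Rightarrow> 'a pair_pre_digraph" where
  "undirected V E = \<lparr> pverts = V, parcs = E \<union> E\<inverse> \<rparr>"

definition graph_C4 :: "nat pair_pre_digraph" where
  "graph_C4 = undirected {0, 1, 2, 3} {(0, 1), (1, 2), (2, 3), (3, 0)}"

definition graph_P4 :: "nat pair_pre_digraph" where
  "graph_P4 = undirected {0, 1, 2, 3} {(0, 1), (1, 2), (2, 3)}"

definition graph_2K2 :: "nat pair_pre_digraph" where
  "graph_2K2 = undirected {0, 1, 2, 3} {(0, 1), (2, 3)}"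

definition has_induced_copy :: "('a, 'b) pre_digraph \<Rightarrow> ('c, 'd) pre_digraph \<Rightarrow> bool" where
  "has_induced_copy G F \<longleftrightarrow> (\<exists>H. induced_subgraph H G \<and> digraph_iso H F)"

definition threshold_graph :: "('a, 'b) pre_digraph \<Rightarrow> bool" where
  "threshold_graph G \<longleftrightarrow>
    \<not> has_induced_copy G (with_proj graph_C4) \<and>
    \<not> has_induced_copy G (with_proj graph_P4) \<and>
    \<not> has_induced_copy G (with_proj graph_2K2)"

end

theory Submission
  imports Defs
begin

text \<open>
  An involution and a commuting element of order 3 generate a cyclic group of order 6 in which
  neither is a power of the other, so they are adjacent in the difference graph; elements that do
  not commute are never adjacent. Hence the edges (1 2) -- (3 4 5) and (1 3) -- (2 4 5) induce a
  copy of 2K2. A split graph contains no such copy either, since the clique would have to contain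
  an endpoint of each of the two edges.
\<close>

lemma (in group) commute_if_in_generate_singleton:
  assumes "c \<in> carrier G" "x \<in> generate G {c}" "y \<in> generate G {c}"
  shows "x \<otimes> y = y \<otimes> x"
proof -
  obtain i j :: int where "x = c [^] i" "y = c [^] j"
    using assms by (auto simp: generate_pow)
  then show ?thesis
    using assms(1) by (simp flip: int_pow_mult add: add.commute)
qed

text \<open>The exponents come from the Chinese remainder theorem: 3 is 1 mod 2 and 0 mod 3, while 4
  is 0 mod 2 and 1 mod 3. So the third power of \<open>a \<otimes> b\<close> is \<open>a\<close> and
  the fourth is \<open>b\<close>.\<close>

lemma (in group) in_generate_mult_if_commute:
  assumes [simp]: "a \<in> carrier G" "b \<in> carrier G"
    and comm: "a \<otimes> b = b \<otimes> a"
    and a2: "a [^] (2::nat) = \<one>" and b3: "b [^] (3::nat) = \<one>"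
  shows "a \<in> generate G {a \<otimes> b}" "b \<in> generate G {a \<otimes> b}"
proof -
  have pow: "(a \<otimes> b) [^] k = a [^] k \<otimes> b [^] k" for k :: nat
    using comm by (intro pow_mult_distrib) auto
  have "a [^] (3::nat) = a [^] (2::nat) \<otimes> a" "b [^] (4::nat) = b [^] (3::nat) \<otimes> b"
    "a [^] (4::nat) = a [^] (2::nat) \<otimes> a [^] (2::nat)"
    by (simp_all add: numeral_eq_Suc m_assoc)
  then have "(a \<otimes> b) [^] (3::nat) = a" "(a \<otimes> b) [^] (4::nat) = b"
    using a2 b3 by (simp_all add: pow)
  then have "a = (a \<otimes> b) [^] (3::int)" "b = (a \<otimes> b) [^] (4::int)"
    by (metis int_pow_int of_nat_numeral)+
  then show "a \<in> generate G {a \<otimes> b}" "b \<in> generate G {a \<otimes> b}"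
    by (auto simp: generate_pow)
qed

text \<open>Deleting isolated vertices changes no arcs, so only the two power graphs matter
  here.\<close>

lemma parcs_difference_graph:
  "(a, b) \<in> parcs (difference_graph G) \<longleftrightarrow>
    a \<in> carrier G \<and> b \<in> carrier G \<and> a \<noteq> b \<and>
    (\<exists>c\<in>carrier G. a \<in> generate G {c} \<and> b \<in> generate G {c}) \<and>
    a \<notin> generate G {b} \<and> b \<notin> generate G {a}"
  by (auto simp: difference_graph_def delete_isolated_def graph_minus_def
      enhanced_power_graph_def power_graph_def)

lemma (in group) difference_graph_adjacent_commute:
  assumes "(a, b) \<in> parcs (difference_graph G)"
  shows "a \<otimes> b = b \<otimes> a"
  using assms commute_if_in_generate_singleton by (auto simp: parcs_difference_graph)

text \<open>The stabilizer of a point is a subgroup. This serves to show that a permutation moving a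
  fixed point of \<open>s\<close> is not a power of \<open>s\<close>.\<close>

lemma fixpoint_generate_sym_group:
  assumes "s \<in> carrier (sym_group n)" "s x = x" "p \<in> generate (sym_group n) {s}"
  shows "p x = x"
  using assms(3)
proof (induction rule: generate.induct)
  case (inv h)
  then have "h \<in> carrier (sym_group n)" "h x = x" using assms by auto
  then show ?case
    by (simp add: sym_group_carrier permutes_inv_eq)
qed (use assms(2) in \<open>auto simp: sym_group_one sym_group_mult\<close>)

lemma sym_group_difference_graph_arc:
  fixes i j k l m n :: nat
  assumes "distinct [i, j, k, l, m]" "{i, j, k, l, m} \<subseteq> {1..n}"
  shows "(cycle_of_list [i, j], cycle_of_list [k, l, m]) \<in> parcs (difference_graph (sym_group n))"
proof -
  interpret group "sym_group n" by (rule sym_group_is_group)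
  let ?a = "cycle_of_list [i, j]" and ?b = "cycle_of_list [k, l, m]"
  have a: "?a \<in> carrier (sym_group n)" and b: "?b \<in> carrier (sym_group n)"
    using assms(2) permutes_subset[OF cycle_permutes, of "[i, j]" "{1..n}"]
      permutes_subset[OF cycle_permutes, of "[k, l, m]" "{1..n}"]
    unfolding sym_group_carrier by auto
  have "?a \<otimes>\<^bsub>sym_group n\<^esub> ?b = ?b \<otimes>\<^bsub>sym_group n\<^esub> ?a"
    using assms(1) by (auto simp: sym_group_mult fun_eq_iff transpose_def)
  moreover have "?a [^]\<^bsub>sym_group n\<^esub> (2::nat) = \<one>\<^bsub>sym_group n\<^esub>"
    using assms(1) by (auto simp: sym_group_mult sym_group_one numeral_eq_Suc)
  moreover have "?b [^]\<^bsub>sym_group n\<^esub> (3::nat) = \<one>\<^bsub>sym_group n\<^esub>"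
    using assms(1)
    by (auto simp: sym_group_mult sym_group_one numeral_eq_Suc fun_eq_iff transpose_def)
  ultimately have "?a \<in> generate (sym_group n) {?a \<otimes>\<^bsub>sym_group n\<^esub> ?b}"
    "?b \<in> generate (sym_group n) {?a \<otimes>\<^bsub>sym_group n\<^esub> ?b}"
    using in_generate_mult_if_commute[OF a b] by blast+
  \<comment> \<open>Each cycle moves a point that the other fixes, so neither is a power of the
    other.\<close>
  moreover have "?a i \<noteq> i" "?b i = i" "?a k = k" "?b k \<noteq> k"
    using assms(1) by (auto simp: transpose_def)
  then have "?a \<noteq> ?b" "?a \<notin> generate (sym_group n) {?b}" "?b \<notin> generate (sym_group n) {?a}"
    using fixpoint_generate_sym_group[OF b, of i ?a] fixpoint_generate_sym_group[OF a, of k ?b]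
    by metis+
  ultimately show ?thesis
    using a b m_closed[OF a b] unfolding parcs_difference_graph by blast
qed

text \<open>Meant for a \<open>pair_graph\<close>: there, symmetry supplies the reversed arcs and
  excludes the reversed cross arcs, and loop-freeness gives that \<open>a\<close>, \<open>b\<close>
  differ and that \<open>c\<close>, \<open>d\<close> differ.\<close>

definition induces_2K2 :: "'a pair_pre_digraph \<Rightarrow> 'a \<Rightarrow> 'a \<Rightarrow> 'a \<Rightarrow> 'a \<Rightarrow> bool" where
  "induces_2K2 D a b c d \<longleftrightarrow>
    (a, b) \<in> parcs D \<and> (c, d) \<in> parcs D \<and> {a, b} \<inter> {c, d} = {} \<and>
    (\<forall>u\<in>{a, b}. \<forall>v\<in>{c, d}. (u, v) \<notin> parcs D)"

lemma not_split_graph_if_induces_2K2: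
  assumes "pair_graph D" "induces_2K2 D a b c d"
  shows "\<not> split_graph (with_proj D)"
proof
  interpret pair_graph D by fact
  assume "split_graph (with_proj D)"
  then obtain A B where AB: "A \<union> B = pverts D"
    and clique: "complete_digraph (card A) (with_proj D \<restriction> A)"
    and indep: "arcs (with_proj D \<restriction> B) = {}"
    by (auto simp: split_graph_def)
  \<comment> \<open>Otherwise both ends would lie in the edgeless part \<open>B\<close>.\<close>
  have "u \<in> A \<or> v \<in> A" if "(u, v) \<in> parcs D" for u v
    proof -
    have "u \<in> pverts D" "v \<in> pverts D"
      using that wellformed by fastforce+
    then show ?thesis
      using that AB indep by fastforce
  qed
  then obtain u v where uv: "u \<in> {a, b}" "v \<in> {c, d}" "u \<in> A" "v \<in> A"
    using assms(2) unfolding induces_2K2_def by (metis insertCI)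
  moreover have "u \<noteq> v"
    using uv assms(2) by (auto simp: induces_2K2_def)
  ultimately have "(u, v) \<in> arcs_ends (with_proj D \<restriction> A)"
    using clique by (simp add: complete_digraph_def)
  then have "(u, v) \<in> parcs D"
    by (auto simp: arcs_ends_conv)
  then show False
    using uv assms(2) by (auto simp: induces_2K2_def)
qed

text \<open>The subgraph induced on the four vertices is the image of \<open>graph_2K2\<close> under
  the relabelling of 0, 1, 2, 3 as \<open>a\<close>, \<open>b\<close>, \<open>c\<close>,
  \<open>d\<close>; list indexing \<open>?f\<close> is this relabelling.\<close>

lemma has_induced_copy_if_induces_2K2:
  assumes "pair_graph D" "induces_2K2 D a b c d"
  shows "has_induced_copy (with_proj D) (with_proj graph_2K2)"
proof -
  interpret pair_graph D by fact
  let ?V = "{a, b, c, d}"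
  let ?H = "with_proj D \<restriction> ?V"
  let ?f = "(!) [a, b, c, d]"
  let ?iso = "\<lparr> iso_verts = ?f, iso_arcs = map_prod ?f ?f, iso_head = snd, iso_tail = fst \<rparr>"
  have arcs: "(a, b) \<in> parcs D" "(c, d) \<in> parcs D"
    and sep: "{a, b} \<inter> {c, d} = {}"
    and non: "\<And>u v. u \<in> {a, b} \<Longrightarrow> v \<in> {c, d} \<Longrightarrow> (u, v) \<notin> parcs D"
    using assms(2) unfolding induces_2K2_def by auto
  have sym: "(v, u) \<in> parcs D \<longleftrightarrow> (u, v) \<in> parcs D" for u v
    using arcs_symmetric by blast
  have irrefl: "(u, u) \<notin> parcs D" for u
    using no_loops by fastforce
  have V: "?V \<subseteq> pverts D"
    using arcs wellformed by fastforce
  have inj: "inj_on ?f {0, 1, 2, 3}"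
    using arcs sep irrefl by (auto simp: inj_on_def)
  have wf: "wf_digraph (with_proj graph_2K2)"
    by unfold_locales (auto simp: graph_2K2_def undirected_def)
  have "(b, a) \<in> parcs D" "(d, c) \<in> parcs D"
    using arcs sym by blast+
  moreover have "(v, u) \<notin> parcs D" if "u \<in> {a, b}" "v \<in> {c, d}" for u v
    using non that sym by blast
  ultimately have "u \<in> ?V \<and> v \<in> ?V \<and> (u, v) \<in> parcs D \<longleftrightarrow>
      (u, v) \<in> {(a, b), (b, a), (c, d), (d, c)}" for u v
    using arcs non irrefl by blast
  then have parcs_H: "arcs ?H = {(a, b), (b, a), (c, d), (d, c)}"
    unfolding set_eq_iff split_paired_All induce_subgraph_arcs with_proj_simps
      mem_Collect_eq fst_conv snd_conv by blast
  have K: "pverts graph_2K2 = {0, 1, 2, 3}" "parcs graph_2K2 = {(0, 1), (1, 0), (2, 3), (3, 2)}"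
    by (auto simp: graph_2K2_def undirected_def)
  have "inj_on (map_prod ?f ?f) (parcs graph_2K2)"
    by (rule inj_on_subset[OF map_prod_inj_on[OF inj inj]]) (simp add: K)
  then have "pre_digraph.digraph_isomorphism (with_proj graph_2K2) ?iso"
    using wf inj by (simp add: pre_digraph.digraph_isomorphism_def K)
  moreover have "?H = app_iso ?iso (with_proj graph_2K2)"
    by (rule pre_digraph.equality) (simp_all add: parcs_H K del: induce_subgraph_arcs)
  \<comment> \<open>The map \<open>?iso\<close> goes from \<open>graph_2K2\<close> to
    \<open>?H\<close>, so the isomorphism has to be reversed.\<close>
  ultimately have "digraph_iso ?H (with_proj graph_2K2)"
    using digraph_iso_swap[OF wf] by (auto simp: digraph_iso_def)
  moreover have "induced_subgraph ?H (with_proj D)"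
    using V by (intro induced_induce) auto
  ultimately show ?thesis
    by (auto simp: has_induced_copy_def)
qed

theorem theorem5p3:
  fixes n :: nat
  assumes "n \<ge> 5"
  shows "\<not> split_graph (with_proj (difference_graph (sym_group n))) \<and>
         \<not> threshold_graph (with_proj (difference_graph (sym_group n)))"
proof -
  let ?D = "difference_graph (sym_group n)"
  let ?a = "cycle_of_list [1, 2::nat]" and ?b = "cycle_of_list [3, 4, 5::nat]"
  let ?c = "cycle_of_list [1, 3::nat]" and ?d = "cycle_of_list [2, 4, 5::nat]"
  have D: "pair_graph ?D"
    by (intro pair_graph_difference_graph) (simp add: sym_group_def finite_permutations)
  \<comment> \<open>One point at which the two products differ rules out adjacency and also
    equality, since equal permutations commute.\<close>
  have non_arc: "(u, v) \<notin> parcs ?D \<and> u \<noteq> v" if "u (v x) \<noteq> v (u x)" for u v x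
    using that group.difference_graph_adjacent_commute[OF sym_group_is_group, of u v n]
    by (metis comp_apply sym_group_mult)
  \<comment> \<open>Each pair of cycles partitions the letters 1 to 5, all available as
    \<open>n\<close> is at least 5.\<close>
  have "(?a, ?b) \<in> parcs ?D" "(?c, ?d) \<in> parcs ?D"
    using assms by (intro sym_group_difference_graph_arc; simp)+
  \<comment> \<open>The point 1 detects non-commutation except for \<open>?b\<close> and
    \<open>?d\<close>, which both fix it; there 2 works, as \<open>?d\<close> sends it from a fixed
    point of \<open>?b\<close> to a moved one.\<close>
  moreover have "?a (?c 1) \<noteq> ?c (?a 1)" "?a (?d 1) \<noteq> ?d (?a 1)"
    "?b (?c 1) \<noteq> ?c (?b 1)" "?b (?d 2) \<noteq> ?d (?b 2)"
    by (simp_all add: transpose_def)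
  note this(1)[THEN non_arc[of ?a ?c 1]] this(2)[THEN non_arc[of ?a ?d 1]]
    this(3)[THEN non_arc[of ?b ?c 1]] this(4)[THEN non_arc[of ?b ?d 2]]
  ultimately have "induces_2K2 ?D ?a ?b ?c ?d"
    unfolding induces_2K2_def by (simp del: cycle_of_list.simps)
  then show ?thesis
    using not_split_graph_if_induces_2K2[OF D] has_induced_copy_if_induces_2K2[OF D]
    unfolding threshold_graph_def by blast
qed

end
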